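(* For every $\boldsymbol{x}\in\mathbb{R}^K$ the following minimax equality holds: $$\max_{\boldsymbol{\varepsilon}\in\mathcal{E}}\ \max_{i=1,\dots,n+1}\ \min_{v\in\mathbb{R}}\Psi^i_{\boldsymbol{\varepsilon}}(\boldsymbol{x},v)=\min_{\boldsymbol{v}\in\mathbb{R}^{n+1}}\ \max_{\boldsymbol{\varepsilon}\in\mathcal{E}}\ \max_{i=1,\dots,n+1}\Psi^i_{\boldsymbol{\varepsilon}}(\boldsymbol{x},v^i),$$ where $\boldsymbol{v}=(v^1,\dots,v^{n+1})$. In particular, for given $\mu\in\mathbb{R}$, the problem $$\min_{\boldsymbol{x}\in\Delta^K_{box}(\mu)}\ \max_{\boldsymbol{\varepsilon}\in\mathcal{E}}\ \max_{i=1,\dots,n+1}\ \min_{v\in\mathbb{R}}\Psi^i_{\boldsymbol{\varepsilon}}(\boldsymbol{x},v)$$ can be equivalently written as $$\min_{\boldsymbol{x}\in\Delta^K_{box}(\mu)}\ \min_{\boldsymbol{v}\in\mathbb{R}^{n+1}}\ \max_{\boldsymbol{\varepsilon}\in\mathcal{E}}\ \max_{i=1,\dots,n+1}\Psi^i_{\boldsymbol{\varepsilon}}(\boldsymbol{x},v^i).$$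
   Context: Let $(\Omega,\mathcal{F})$ be a measurable space, let $K,m\ge 1$ be integers, and let $R^1,\dots,R^K,Z:\Omega\to\mathbb{R}$ be measurable. Superscripts on $R^k,x^k,v^i,\Psi^i_{\boldsymbol{\varepsilon}}$ are indices, not powers. Let $\mathbb{P}$ be a probability measure on $(\Omega,\mathcal{F})$ under which the random vector $\boldsymbol{S}=(R^1,\dots,R^K,Z)$ is discrete and takes the (pairwise distinct) values $\boldsymbol{s}_1,\dots,\boldsymbol{s}_m\in\mathbb{R}^{K+1}$; set $\pi_j:=\mathbb{P}(\boldsymbol{S}=\boldsymbol{s}_j)$ for $j=1,\dots,m$, so that $\sum_{j=1}^m\pi_j=1$, and $\boldsymbol{\pi}=(\pi_1,\dots,\pi_m)$. Let $\underline{\boldsymbol{\varepsilon}},\overline{\boldsymbol{\varepsilon}}\in\mathbb{R}^m$ satisfy $\underline{\boldsymbol{\varepsilon}}\le\overline{\boldsymbol{\varepsilon}}$ and $\boldsymbol{\pi}+\underline{\boldsymbol{\varepsilon}}\ge\boldsymbol{0}$ (componentwise), and let $$\mathcal{E}:=\left\{\boldsymbol{\varepsilon}\in\mathbb{R}^m : \underline{\boldsymbol{\varepsilon}}\le\boldsymbol{\varepsilon}\le\overline{\boldsymbol{\varepsilon}},\ \sum_{j=1}^m\varepsilon_j=0\right\},$$ understood to be nonempty. For every $\boldsymbol{\varepsilon}\in\mathcal{E}$ let $\mathbb{P}_{\boldsymbol{\varepsilon}}$ be a probability measure on $(\Omega,\mathcal{F})$ such that $\mathbb{P}_{\boldsymbol{\varepsilon}}(\boldsymbol{S}=\boldsymbol{s}_j)=\pi_j+\varepsilon_j$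 for $j=1,\dots,m$, with expectation $\mathbb{E}_{\mathbb{P}_{\boldsymbol{\varepsilon}}}$. Let $n\in\mathbb{N}_0$, and let $0\le\alpha_1<\cdots<\alpha_{n+1}\le 1$ and $0<r_1<\cdots<r_n<r_{n+1}=1$, where $\alpha_1>0$ is implicit in the requirement that the functions $\Psi^i_{\boldsymbol{\varepsilon}}$ below, which contain the factor $1/\alpha_i$, be real-valued. Let $\Delta^K$ be the set of vectors in $\mathbb{R}^K$ with nonnegative components summing to $1$, and for $\mu\in\mathbb{R}$ let $$\Delta^K_{box}(\mu):=\left\{\boldsymbol{x}\in\Delta^K : \min_{\boldsymbol{\varepsilon}\in\mathcal{E}}\sum_{k=1}^K x^k\,\mathbb{E}_{\mathbb{P}_{\boldsymbol{\varepsilon}}}(R^k)\ge\mu\right\}.$$ For $i=1,\dots,n+1$, $\boldsymbol{\varepsilon}\in\mathcal{E}$ and $\boldsymbol{x}\in\mathbb{R}^K$ define the function $\Psi^i_{\boldsymbol{\varepsilon}}(\boldsymbol{x},\cdot):\mathbb{R}\to\mathbb{R}$ by $$\Psi^i_{\boldsymbol{\varepsilon}}(\boldsymbol{x},v):=\frac{1}{\alpha_i}\,\mathbb{E}_{\mathbb{P}_{\boldsymbol{\varepsilon}}}\left(\max\left\{v-\sum_{k=1}^K x^kR^k+r_iZ,\,0\right\}\right)-v.$$ *)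

theory Defs
  imports "HOL-Probability.Probability"
begin

(* A "min"/"max" over an infinite set is written as INF/SUP. On the reals these are
   meaningful only together with the matching attains_min/attains_max fact, which a
   statement involving them therefore has to supply. *)
definition attains_min :: "('a \<Rightarrow> real) \<Rightarrow> 'a set \<Rightarrow> bool" where
  "attains_min f A \<longleftrightarrow> (\<exists>a. is_arg_min f (\<lambda>a. a \<in> A) a)"

definition attains_max :: "('a \<Rightarrow> real) \<Rightarrow> 'a set \<Rightarrow> bool" where
  "attains_max f A \<longleftrightarrow> (\<exists>a. is_arg_max f (\<lambda>a. a \<in> A) a)"

definition return_vector ::
    "('k::finite \<Rightarrow> 'a \<Rightarrow> real) \<Rightarrow> ('a \<Rightarrow> real) \<Rightarrow> 'a \<Rightarrow> (real ^ 'k) \<times> real" where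
  "return_vector R Z \<omega> = ((\<chi> k. R k \<omega>), Z \<omega>)"

(* The order on vectors is componentwise. *)
definition perturbations :: "real ^ 'm \<Rightarrow> real ^ 'm \<Rightarrow> (real ^ 'm) set" where
  "perturbations lo hi = {\<epsilon>. lo \<le> \<epsilon> \<and> \<epsilon> \<le> hi \<and> (\<Sum>j\<in>UNIV. \<epsilon> $ j) = 0}"

definition prob_simplex :: "(real ^ 'k) set" where
  "prob_simplex = {x. (\<forall>k. 0 \<le> x $ k) \<and> (\<Sum>k\<in>UNIV. x $ k) = 1}"

definition expected_return ::
    "('e \<Rightarrow> 'a measure) \<Rightarrow> ('k::finite \<Rightarrow> 'a \<Rightarrow> real) \<Rightarrow> real ^ 'k \<Rightarrow> 'e \<Rightarrow> real" where
  "expected_return Q R x \<epsilon> = (\<Sum>k\<in>UNIV. x $ k * (\<integral>\<omega>. R k \<omega> \<partial>Q \<epsilon>))"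

definition simplex_box ::
    "'e set \<Rightarrow> ('e \<Rightarrow> 'a measure) \<Rightarrow> ('k::finite \<Rightarrow> 'a \<Rightarrow> real) \<Rightarrow> real \<Rightarrow> (real ^ 'k) set" where
  "simplex_box E Q R \<mu> = {x \<in> prob_simplex. (INF \<epsilon>\<in>E. expected_return Q R x \<epsilon>) \<ge> \<mu>}"

(* The index i is meant to range over {1..n + 1}; a point of the space of v's is an
   extensional function on that set. *)
definition Psi ::
    "('e \<Rightarrow> 'a measure) \<Rightarrow> ('k::finite \<Rightarrow> 'a \<Rightarrow> real) \<Rightarrow> ('a \<Rightarrow> real) \<Rightarrow> (nat \<Rightarrow> real) \<Rightarrow> (nat \<Rightarrow> real) \<Rightarrow>
      'e \<Rightarrow> nat \<Rightarrow> real ^ 'k \<Rightarrow> real \<Rightarrow> real" where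
  "Psi Q R Z \<alpha> r \<epsilon> i x v =
     1 / \<alpha> i * (\<integral>\<omega>. max (v - (\<Sum>k\<in>UNIV. x $ k * R k \<omega>) + r i * Z \<omega>) 0 \<partial>Q \<epsilon>) - v"

end

theory Submission
  imports Defs
begin

text \<open>Under each perturbed measure the expectation is a finite sum with weights
  \<open>\<pi> $ j + \<epsilon> $ j\<close>, so every \<open>\<Psi> \<epsilon> i x v\<close> is affine in \<open>\<epsilon>\<close> and jointly convex in \<open>(x, v)\<close>.
  The perturbations form a compact convex set, and since \<open>1 / \<alpha> i \<ge> 1\<close> truncating \<open>v\<close> to a
  large interval does not increase \<open>\<Psi>\<close>, simultaneously for all \<open>\<epsilon>\<close>. A connectedness argument
  then gives a saddle point for each index \<open>i\<close>, and the equality follows because the coordinates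
  of \<open>v\<close> are decoupled. The common value is convex in \<open>x\<close>, hence continuous, so it attains
  its minimum on the compact set \<open>simplex_box E Q R \<mu>\<close>.\<close>

subsection \<open>Attainment of extrema\<close>

lemma attains_min_iff: "attains_min f A \<longleftrightarrow> (\<exists>a\<in>A. \<forall>b\<in>A. f a \<le> f b)"
  by (force simp: attains_min_def is_arg_min_def not_less)

lemma attains_max_iff: "attains_max f A \<longleftrightarrow> (\<exists>a\<in>A. \<forall>b\<in>A. f b \<le> f a)"
  by (force simp: attains_max_def is_arg_max_def not_less)

lemma INF_eq_minimum:
  fixes f :: "'a \<Rightarrow> real"
  assumes "a \<in> A" "\<And>b. b \<in> A \<Longrightarrow> f a \<le> f b"
  shows "(INF b\<in>A. f b) = f a"
  using assms by (intro cInf_eq_minimum) auto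

lemma SUP_eq_maximum:
  fixes f :: "'a \<Rightarrow> real"
  assumes "a \<in> A" "\<And>b. b \<in> A \<Longrightarrow> f b \<le> f a"
  shows "(SUP b\<in>A. f b) = f a"
  using assms by (intro cSup_eq_maximum) auto

lemma attains_minD:
  assumes "attains_min f A" "b \<in> A"
  shows "(INF a\<in>A. f a) \<le> f b"
  using assms INF_eq_minimum[of _ A f] unfolding attains_min_iff by metis

lemma attains_maxD:
  assumes "attains_max f A" "b \<in> A"
  shows "f b \<le> (SUP a\<in>A. f a)"
  using assms SUP_eq_maximum[of _ A f] unfolding attains_max_iff by metis

lemma compact_attains_min:
  fixes f :: "'a::topological_space \<Rightarrow> real"
  assumes "compact A" "A \<noteq> {}" "continuous_on A f"
  shows "attains_min f A"
  unfolding attains_min_iff using continuous_attains_inf[OF assms] by blast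

lemma compact_attains_max:
  fixes f :: "'a::topological_space \<Rightarrow> real"
  assumes "compact A" "A \<noteq> {}" "continuous_on A f"
  shows "attains_max f A"
  unfolding attains_max_iff using continuous_attains_sup[OF assms] by blast

subsection \<open>A minimax theorem\<close>

lemma continuous_on_slice:
  assumes "continuous_on (E \<times> UNIV) (\<lambda>(e, v). f e v)"
  shows "continuous_on E (\<lambda>e. f e v)"
proof -
  have "continuous_on E (\<lambda>e. (e, v))"
    by (intro continuous_intros)
  from continuous_on_compose2[OF assms this] show ?thesis by auto
qed

lemma closed_superlevel:
  fixes f :: "'a::topological_space \<Rightarrow> real"
  assumes "closed A" "continuous_on A f"
  shows "closed {a \<in> A. c \<le> f a}"
proof -
  have "closed (A \<inter> f -` {c..})"
    using assms by (intro continuous_closed_preimage) auto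
  moreover have "A \<inter> f -` {c..} = {a \<in> A. c \<le> f a}" by auto
  ultimately show ?thesis by simp
qed

lemma convex_on_segment_le_max:
  assumes f: "convex_on UNIV f" and v: "v \<in> closed_segment a b"
  shows "f v \<le> max (f a) (f b)"
proof -
  obtain u where u: "0 \<le> u" "u \<le> 1" and v: "v = (1 - u) *\<^sub>R a + u *\<^sub>R b"
    using v by (auto simp: in_segment)
  have "f v \<le> (1 - u) * f a + u * f b"
    using convex_onD[OF f u] v by simp
  also have "\<dots> \<le> (1 - u) * max (f a) (f b) + u * max (f a) (f b)"
    using u by (intro add_mono mult_left_mono) auto
  finally show ?thesis by (simp add: algebra_simps)
qed

text \<open>If the superlevel sets of \<open>v1\<close> and \<open>v2\<close> were disjoint, then for \<open>v\<close> on the segment between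
  them the connected superlevel set of \<open>v\<close> would lie in exactly one of the two; both alternatives
  are closed conditions on \<open>v\<close>, which contradicts the connectedness of the segment.\<close>

lemma superlevel_sets_meet_pair:
  fixes f :: "'e::euclidean_space \<Rightarrow> 'v::euclidean_space \<Rightarrow> real"
  assumes E: "compact E"
    and cont: "continuous_on (E \<times> UNIV) (\<lambda>(e, v). f e v)"
    and quasi: "\<And>v. convex {e \<in> E. c \<le> f e v}"
    and conv: "\<And>e. e \<in> E \<Longrightarrow> convex_on UNIV (f e)"
    and ne: "\<And>v. \<exists>e\<in>E. c \<le> f e v"
  shows "\<exists>e\<in>E. c \<le> f e v1 \<and> c \<le> f e v2"
proof (rule ccontr)
  assume contra: "\<not> ?thesis"
  define C where "C v = {e \<in> E. c \<le> f e v}" for v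
  note cont1 = continuous_on_slice[OF cont]
  have closed: "closed (C v)" for v
    unfolding C_def
    by (rule closed_superlevel[OF compact_imp_closed[OF E] cont1])
  have disj: "C v1 \<inter> C v2 = {}"
    using contra by (auto simp: C_def)
  have sub: "C v \<subseteq> C v1 \<union> C v2" if v: "v \<in> closed_segment v1 v2" for v
  proof
    fix e assume e: "e \<in> C v"
    then have eE: "e \<in> E" and ce: "c \<le> f e v" by (auto simp: C_def)
    have "f e v \<le> max (f e v1) (f e v2)"
      using convex_on_segment_le_max[OF conv[OF eE] v] by simp
    with ce eE show "e \<in> C v1 \<union> C v2" by (auto simp: C_def)
  qed
  have one: "C v \<inter> C v1 = {} \<or> C v \<inter> C v2 = {}" if v: "v \<in> closed_segment v1 v2" for v
  proof -
    have "connected (C v)"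
      using quasi by (auto simp: C_def intro: convex_connected)
    then show ?thesis
      using closed[of v1] closed[of v2] sub[OF v] disj unfolding connected_closed by blast
  qed
  \<comment> \<open>\<open>T w\<close> consists of the \<open>v\<close> on the segment whose
    superlevel set meets that of \<open>w\<close>. Writing it as the projection of a compact set of
    pairs \<open>(v, e)\<close> yields its closedness.\<close>
  define T where "T w = fst ` {p \<in> closed_segment v1 v2 \<times> E. c \<le> min (f (snd p) (fst p)) (f (snd p) w)}" for w
  have T_iff: "v \<in> T w \<longleftrightarrow> v \<in> closed_segment v1 v2 \<and> C v \<inter> C w \<noteq> {}" for v w
    by (force simp: T_def C_def)
  have closedT: "closed (T w)" for w
  proof -
    let ?S = "closed_segment v1 v2"
    have "continuous_on (?S \<times> E) (\<lambda>p. (snd p, fst p))"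
      by (intro continuous_intros)
    from continuous_on_compose2[OF cont this]
    have "continuous_on (?S \<times> E) (\<lambda>p. f (snd p) (fst p))" by (auto simp: image_subset_iff)
    moreover have "continuous_on (?S \<times> E) (\<lambda>p. f (snd p) w)"
      by (intro continuous_on_compose2[OF cont1[of w]] continuous_intros) auto
    ultimately have "continuous_on (?S \<times> E) (\<lambda>p. min (f (snd p) (fst p)) (f (snd p) w))"
      by (rule continuous_on_min)
    then have "closed {p \<in> ?S \<times> E. c \<le> min (f (snd p) (fst p)) (f (snd p) w)}"
      by (intro closed_superlevel compact_imp_closed[OF compact_Times] E compact_segment)
    from compact_Int_closed[OF compact_Times[OF compact_segment E] this]
    have "compact {p \<in> ?S \<times> E. c \<le> min (f (snd p) (fst p)) (f (snd p) w)}"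
      by (rule back_subst[where P = compact]) auto
    then show ?thesis
      unfolding T_def
      by (intro compact_imp_closed compact_continuous_image continuous_on_fst continuous_on_id)
  qed
  have neC: "C v \<noteq> {}" for v
    using ne[of v] by (auto simp: C_def)
  have cover: "closed_segment v1 v2 \<subseteq> T v1 \<union> T v2"
    using neC sub by (fastforce simp: T_iff)
  have "v \<notin> T v2" if "v \<in> T v1" for v
    using that one[of v] unfolding T_iff by blast
  then have "T v1 \<inter> T v2 \<inter> closed_segment v1 v2 = {}"
    by blast
  from connected_closedD[OF connected_segment this cover closedT closedT]
  have "T v1 \<inter> closed_segment v1 v2 = {} \<or> T v2 \<inter> closed_segment v1 v2 = {}" .
  moreover have "v1 \<in> T v1" "v2 \<in> T v2"
    using neC by (simp_all add: T_iff)
  ultimately show False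
    by (metis IntI empty_iff ends_in_segment)
qed

text \<open>The induction generalises over \<open>E\<close>: absorbing a point \<open>w\<close>
  replaces \<open>E\<close> by the superlevel set of \<open>w\<close>, inside which the remaining
  points are treated.\<close>

lemma superlevel_sets_meet_finite:
  fixes f :: "'e::euclidean_space \<Rightarrow> 'v::euclidean_space \<Rightarrow> real"
  assumes "finite F"
    and "compact E"
    and "continuous_on (E \<times> UNIV) (\<lambda>(e, v). f e v)"
    and "\<And>v. convex {e \<in> E. c \<le> f e v}"
    and "\<And>e. e \<in> E \<Longrightarrow> convex_on UNIV (f e)"
    and "\<And>v. \<exists>e\<in>E. c \<le> f e v"
  shows "\<exists>e\<in>E. \<forall>v\<in>F. c \<le> f e v"
  using assms
proof (induction F arbitrary: E rule: finite_induct)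
  case empty
  from empty(5) show ?case by auto
next
  case (insert w F)
  \<comment> \<open>The two-point case shows that \<open>?E\<close> satisfies the hypotheses again.\<close>
  let ?E = "{e \<in> E. c \<le> f e w}"
  have "closed ?E"
    by (rule closed_superlevel[OF compact_imp_closed continuous_on_slice, OF insert.prems(1,2)])
  then have "compact ?E"
    using compact_Int_closed[OF insert.prems(1), of ?E] by (simp add: Int_absorb1)
  moreover have "continuous_on (?E \<times> UNIV) (\<lambda>(e, v). f e v)"
    using insert.prems(2) by (rule continuous_on_subset) auto
  moreover have "convex {e \<in> ?E. c \<le> f e v}" for v
  proof -
    have "{e \<in> ?E. c \<le> f e v} = ?E \<inter> {e \<in> E. c \<le> f e v}" by auto
    then show ?thesis using insert.prems(3) by (simp add: convex_Int)
  qed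
  moreover have "convex_on UNIV (f e)" if "e \<in> ?E" for e
    using insert.prems(4) that by simp
  moreover have "\<exists>e\<in>?E. c \<le> f e v" for v
    using superlevel_sets_meet_pair[of E f c w v, OF insert.prems] by auto
  ultimately have "\<exists>e\<in>?E. \<forall>v\<in>F. c \<le> f e v"
    by (rule insert.IH)
  then show ?case by auto
qed

text \<open>The finite intersection property of the compact set \<open>E\<close> carries the result
  from finitely many \<open>v\<close> to all of them.\<close>

lemma superlevel_sets_meet:
  fixes f :: "'e::euclidean_space \<Rightarrow> 'v::euclidean_space \<Rightarrow> real"
  assumes E: "compact E"
    and cont: "continuous_on (E \<times> UNIV) (\<lambda>(e, v). f e v)"
    and quasi: "\<And>v. convex {e \<in> E. c \<le> f e v}"
    and conv: "\<And>e. e \<in> E \<Longrightarrow> convex_on UNIV (f e)"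
    and ne: "\<And>v. \<exists>e\<in>E. c \<le> f e v"
  shows "\<exists>e\<in>E. \<forall>v. c \<le> f e v"
proof -
  note cont1 = continuous_on_slice[OF cont]
  have closed: "closed {e \<in> E. c \<le> f e v}" for v
    by (rule closed_superlevel[OF compact_imp_closed[OF E] cont1])
  have "E \<inter> (\<Inter>v\<in>UNIV. {e \<in> E. c \<le> f e v}) \<noteq> {}"
  proof (rule compact_imp_fip_image[OF E])
    fix F :: "'v set" assume F: "finite F" "F \<subseteq> UNIV"
    show "E \<inter> (\<Inter>v\<in>F. {e \<in> E. c \<le> f e v}) \<noteq> {}"
      using superlevel_sets_meet_finite[OF F(1) E cont quasi conv ne] by auto
  qed (rule closed)
  then show ?thesis by auto
qed

text \<open>Let \<open>w\<close> minimise the upper envelope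
  \<open>g v = (SUP e\<in>E. f e v)\<close>. The superlevel sets at level \<open>g w\<close> have a
  common point \<open>e\<close>, and then \<open>(e, w)\<close> is a saddle point with value
  \<open>g w\<close>.\<close>

lemma saddle_point_exists:
  fixes f :: "'e::euclidean_space \<Rightarrow> real \<Rightarrow> real"
  assumes E: "compact E" "E \<noteq> {}"
    and cont: "continuous_on (E \<times> UNIV) (\<lambda>(e, v). f e v)"
    and quasi: "\<And>c v. convex {e \<in> E. c \<le> f e v}"
    and conv: "\<And>e. e \<in> E \<Longrightarrow> convex_on UNIV (f e)"
    and clamp: "\<And>e v. e \<in> E \<Longrightarrow> f e (max (-B) (min B v)) \<le> f e v" and "0 \<le> B"
  obtains e w where "e \<in> E" "\<And>e'. e' \<in> E \<Longrightarrow> f e' w \<le> f e w" "\<And>v. f e w \<le> f e v"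
proof -
  define g where "g v = (SUP e\<in>E. f e v)" for v
  note cont1 = continuous_on_slice[OF cont]
  have att: "attains_max (\<lambda>e. f e v) E" for v
    by (rule compact_attains_max[OF E cont1])
  have g_ub: "f e v \<le> g v" if "e \<in> E" for e v
    unfolding g_def using attains_maxD[OF att that] .
  have g_le: "g v \<le> b" if "\<And>e. e \<in> E \<Longrightarrow> f e v \<le> b" for v b
    unfolding g_def using E that by (intro cSUP_least)
  \<comment> \<open>A supremum of convex functions is convex; convexity on the whole line then gives
    the continuity needed for a minimiser on \<open>{-B..B}\<close>.\<close>
  have "convex_on UNIV g"
  proof (rule convex_onI)
    fix t x y :: real assume t: "0 < t" "t < 1"
    show "g ((1 - t) *\<^sub>R x + t *\<^sub>R y) \<le> (1 - t) * g x + t * g y"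
    proof (rule g_le)
      fix e assume e: "e \<in> E"
      have "f e ((1 - t) *\<^sub>R x + t *\<^sub>R y) \<le> (1 - t) * f e x + t * f e y"
        using convex_onD[OF conv[OF e], of t x y] t by simp
      also have "\<dots> \<le> (1 - t) * g x + t * g y"
        using t g_ub[OF e] by (intro add_mono mult_left_mono) auto
      finally show "f e ((1 - t) *\<^sub>R x + t *\<^sub>R y) \<le> (1 - t) * g x + t * g y" .
    qed
  qed simp
  then have "continuous_on UNIV g"
    by (intro convex_on_continuous) auto
  then have "attains_min g {-B..B}"
    using \<open>0 \<le> B\<close> by (intro compact_attains_min) (auto intro: continuous_on_subset)
  then obtain w where w: "\<And>v. v \<in> {-B..B} \<Longrightarrow> g w \<le> g v"
    unfolding attains_min_iff by blast
  \<comment> \<open>Since one \<open>B\<close> serves all \<open>e\<close>, the clamping inequality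
    passes to the supremum, so the minimiser on the interval is a global one.\<close>
  have g_min: "g w \<le> g v" for v
  proof -
    have "g w \<le> g (max (-B) (min B v))"
      using \<open>0 \<le> B\<close> by (intro w) auto
    also have "\<dots> \<le> g v"
      by (intro g_le order.trans[OF clamp g_ub])
    finally show ?thesis .
  qed
  \<comment> \<open>A maximiser \<open>e\<close> for this \<open>v\<close> satisfies
    \<open>f e v = g v\<close>, which is at least \<open>g w\<close>; hence every superlevel set at
    level \<open>g w\<close> is nonempty.\<close>
  have "\<exists>e\<in>E. g w \<le> f e v" for v
  proof -
    obtain e where "e \<in> E" "\<forall>e'\<in>E. f e' v \<le> f e v"
      using att[of v] by (auto simp: attains_max_iff)
    then show ?thesis
      using g_min[of v] g_le[of v "f e v"] by force
  qed
  then obtain e where e: "e \<in> E" "\<And>v. g w \<le> f e v"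
    using superlevel_sets_meet[OF E(1) cont quasi conv] by metis
  show thesis
  proof (rule that[OF e(1)])
    show "f e' w \<le> f e w" if "e' \<in> E" for e'
      using g_ub[OF that, of w] e(2)[of w] by linarith
    show "f e w \<le> f e v" for v
      using g_ub[OF e(1), of w] e(2)[of v] by linarith
  qed
qed

section \<open>Finite maxima and the combination of saddle points\<close>

lemma Max_image_le_iff:
  fixes f :: "'i \<Rightarrow> real"
  assumes "finite I" "I \<noteq> {}"
  shows "(MAX i\<in>I. f i) \<le> c \<longleftrightarrow> (\<forall>i\<in>I. f i \<le> c)"
  using assms by simp

lemma le_Max_image:
  fixes f :: "'i \<Rightarrow> real"
  assumes "finite I" "i \<in> I"
  shows "f i \<le> (MAX i\<in>I. f i)"
  using assms by simp

text \<open>No topology on \<open>E\<close> is involved: among the maximisers \<open>e i\<close> for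
  the single indices, the one with the largest value \<open>f (e i) i\<close> also maximises the
  finite maximum.\<close>

lemma attains_max_Max:
  fixes f :: "'e \<Rightarrow> 'i \<Rightarrow> real"
  assumes I: "finite I" "I \<noteq> {}" and f: "\<And>i. i \<in> I \<Longrightarrow> attains_max (\<lambda>e. f e i) E"
  shows "attains_max (\<lambda>e. MAX i\<in>I. f e i) E"
proof -
  have "\<forall>i\<in>I. \<exists>e\<in>E. \<forall>e'\<in>E. f e' i \<le> f e i"
    using f by (simp add: attains_max_iff)
  then obtain e where e: "\<And>i. i \<in> I \<Longrightarrow> e i \<in> E"
      "\<And>i e'. i \<in> I \<Longrightarrow> e' \<in> E \<Longrightarrow> f e' i \<le> f (e i) i"
    by metis
  have "(MAX i\<in>I. f (e i) i) \<in> (\<lambda>i. f (e i) i) ` I"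
    using I by (intro Max_in) auto
  then obtain k where "k \<in> I" "(MAX i\<in>I. f (e i) i) = f (e k) k"
    by auto
  then have k: "k \<in> I" "\<And>i. i \<in> I \<Longrightarrow> f (e i) i \<le> f (e k) k"
    using le_Max_image[OF I(1), of _ "\<lambda>i. f (e i) i"] by auto
  have "(MAX i\<in>I. f e' i) \<le> (MAX i\<in>I. f (e k) i)" if "e' \<in> E" for e'
    unfolding Max_image_le_iff[OF I]
    using e(2)[OF _ that] k le_Max_image[OF I(1) k(1), of "f (e k)"] by (meson order.trans)
  then show ?thesis
    unfolding attains_max_iff using e(1) k(1) by auto
qed

text \<open>Saddle points of the individual games decouple: the largest of their values is the value
  of both sides, since each coordinate \<open>v i\<close> only enters the game with index \<open>i\<close>.\<close>

lemma minimax_of_saddle_points: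
  fixes f :: "'e \<Rightarrow> 'i \<Rightarrow> real \<Rightarrow> real"
  assumes I: "finite I" "I \<noteq> {}"
    and e: "\<And>i. i \<in> I \<Longrightarrow> e i \<in> E"
    and saddle_max: "\<And>i e'. i \<in> I \<Longrightarrow> e' \<in> E \<Longrightarrow> f e' i (w i) \<le> f (e i) i (w i)"
    and saddle_min: "\<And>i v. i \<in> I \<Longrightarrow> f (e i) i (w i) \<le> f (e i) i v"
    and att_v: "\<And>e i. e \<in> E \<Longrightarrow> i \<in> I \<Longrightarrow> attains_min (f e i) UNIV"
    and att_e: "\<And>i v. i \<in> I \<Longrightarrow> attains_max (\<lambda>e. f e i v) E"
  defines "val \<equiv> (MAX i\<in>I. f (e i) i (w i))"
    and "V \<equiv> I \<rightarrow>\<^sub>E UNIV"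
  shows "attains_max (\<lambda>e. MAX i\<in>I. INF v. f e i v) E"
    and "(SUP e\<in>E. MAX i\<in>I. INF v. f e i v) = val"
    and "attains_min (\<lambda>v. SUP e\<in>E. MAX i\<in>I. f e i (v i)) V"
    and "(INF v\<in>V. SUP e\<in>E. MAX i\<in>I. f e i (v i)) = val"
proof -
  have INF_le: "(INF v. f e' i v) \<le> f e' i v" if "e' \<in> E" "i \<in> I" for e' i v
    using attains_minD[OF att_v[OF that]] by simp
  have att: "attains_max (\<lambda>e. MAX i\<in>I. f e i (v i)) E" for v
    by (rule attains_max_Max[OF I att_e])
  \<comment> \<open>The index \<open>k\<close> of the game with the largest value supplies
    \<open>e k\<close>, which attains the left side and bounds the right side from below for every
    \<open>v\<close>.\<close>
  have "val \<in> (\<lambda>i. f (e i) i (w i)) ` I"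
    unfolding val_def using I by (intro Max_in) auto
  then obtain k where k: "k \<in> I" "val = f (e k) k (w k)"
    by auto
  have le_val: "f (e i) i (w i) \<le> val" if "i \<in> I" for i
    unfolding val_def using le_Max_image[OF I(1) that] .
  have L_le: "(MAX i\<in>I. INF v. f e' i v) \<le> val" if e': "e' \<in> E" for e'
    unfolding Max_image_le_iff[OF I]
    using INF_le[OF e'] saddle_max[OF _ e'] le_val by (meson order.trans)
  have "val \<le> (INF v. f (e k) k v)"
    using saddle_min[OF k(1)] k(2) by (intro cINF_greatest) auto
  also have "\<dots> \<le> (MAX i\<in>I. INF v. f (e k) i v)"
    using le_Max_image[OF I(1) k(1)] .
  finally have L_eq: "(MAX i\<in>I. INF v. f (e k) i v) = val"
    using L_le[OF e[OF k(1)]] by simp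
  show "attains_max (\<lambda>e. MAX i\<in>I. INF v. f e i v) E"
    unfolding attains_max_iff using L_le L_eq e[OF k(1)] by auto
  show "(SUP e\<in>E. MAX i\<in>I. INF v. f e i v) = val"
    using SUP_eq_maximum[of "e k" E "\<lambda>e. MAX i\<in>I. INF v. f e i v"] L_le L_eq e[OF k(1)] by auto
  have R_ge: "val \<le> (SUP e\<in>E. MAX i\<in>I. f e i (v i))" for v
  proof -
    have "val \<le> f (e k) k (v k)"
      using saddle_min[OF k(1)] k(2) by simp
    also have "\<dots> \<le> (MAX i\<in>I. f (e k) i (v i))"
      using le_Max_image[OF I(1) k(1)] .
    also have "\<dots> \<le> (SUP e\<in>E. MAX i\<in>I. f e i (v i))"
      using attains_maxD[OF att e[OF k(1)]] .
    finally show ?thesis .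
  qed
  \<comment> \<open>The minimising vector collects the points \<open>w i\<close>; the restriction
    makes it extensional, as membership in \<open>V\<close> demands.\<close>
  have "(SUP e\<in>E. MAX i\<in>I. f e i (restrict w I i)) \<le> val"
  proof (rule cSUP_least)
    show "E \<noteq> {}" using e[OF k(1)] by auto
    show "(MAX i\<in>I. f e' i (restrict w I i)) \<le> val" if "e' \<in> E" for e'
      unfolding Max_image_le_iff[OF I]
      using saddle_max[OF _ that] le_val by (auto intro: order.trans)
  qed
  then have R_eq: "(SUP e\<in>E. MAX i\<in>I. f e i (restrict w I i)) = val"
    using R_ge[of "restrict w I"] by simp
  have wV: "restrict w I \<in> V"
    by (simp add: V_def)
  show "attains_min (\<lambda>v. SUP e\<in>E. MAX i\<in>I. f e i (v i)) V"
    unfolding attains_min_iff by (intro bexI[OF _ wV] ballI) (simp only: R_eq R_ge)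
  show "(INF v\<in>V. SUP e\<in>E. MAX i\<in>I. f e i (v i)) = val"
    unfolding R_eq[symmetric] by (rule INF_eq_minimum[OF wV]) (simp only: R_eq R_ge)
qed

text \<open>The value of each game is a partial minimum over \<open>v\<close> of a supremum of
  jointly convex functions, hence convex in \<open>x\<close>; the proof works with the saddle points
  directly.\<close>

lemma convex_on_max_of_saddle_points:
  fixes f :: "'e \<Rightarrow> 'i \<Rightarrow> 'x::real_vector \<Rightarrow> real \<Rightarrow> real"
  assumes I: "finite I" "I \<noteq> {}"
    and e: "\<And>i x. i \<in> I \<Longrightarrow> e x i \<in> E"
    and saddle_max: "\<And>i e' x. i \<in> I \<Longrightarrow> e' \<in> E \<Longrightarrow> f e' i x (w x i) \<le> f (e x i) i x (w x i)"
    and saddle_min: "\<And>i v x. i \<in> I \<Longrightarrow> f (e x i) i x (w x i) \<le> f (e x i) i x v"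
    and conv: "\<And>e i. e \<in> E \<Longrightarrow> i \<in> I \<Longrightarrow> convex_on UNIV (\<lambda>(x, v). f e i x v)"
  shows "convex_on UNIV (\<lambda>x. MAX i\<in>I. f (e x i) i x (w x i))"
proof (rule convex_onI)
  fix t :: real and x y :: 'x assume t: "0 < t" "t < 1"
  let ?val = "\<lambda>x. MAX i\<in>I. f (e x i) i x (w x i)"
  let ?z = "(1 - t) *\<^sub>R x + t *\<^sub>R y"
  show "?val ?z \<le> (1 - t) * ?val x + t * ?val y"
    unfolding Max_image_le_iff[OF I]
  proof
    fix i assume i: "i \<in> I"
    \<comment> \<open>The perturbation is frozen at the saddle point of the convex combination. At
      the end points \<open>x\<close> and \<open>y\<close> it is only a competitor, so by
      \<open>saddle_max\<close> it stays below the values there.\<close>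
    let ?e = "e ?z i"
    have le_val: "f ?e i u (w u i) \<le> ?val u" for u
      using saddle_max[OF i e[OF i, of ?z], of u] le_Max_image[OF I(1) i, of "\<lambda>i. f (e u i) i u (w u i)"]
      by linarith
    have "f ?e i ?z (w ?z i) \<le> f ?e i ?z ((1 - t) *\<^sub>R w x i + t *\<^sub>R w y i)"
      by (rule saddle_min[OF i])
    also have "\<dots> \<le> (1 - t) * f ?e i x (w x i) + t * f ?e i y (w y i)"
      using convex_onD[OF conv[OF e[OF i] i], of t "(x, w x i)" "(y, w y i)"] t by simp
    also have "\<dots> \<le> (1 - t) * ?val x + t * ?val y"
      using t le_val by (intro add_mono mult_left_mono) auto
    finally show "f ?e i ?z (w ?z i) \<le> (1 - t) * ?val x + t * ?val y" .
  qed
qed simp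

text \<open>Minimising in two stages agrees with joint minimisation, because the inner minimum is
  attained at some \<open>w x\<close> for every \<open>x\<close>.\<close>

lemma is_arg_min_iterated:
  fixes g :: "'x \<Rightarrow> 'v \<Rightarrow> real"
  assumes att: "\<And>x. attains_min (g x) V" and h: "\<And>x. h x = (INF v\<in>V. g x v)"
  shows "is_arg_min h (\<lambda>x. x \<in> D) x \<longleftrightarrow>
    (\<exists>v. is_arg_min (\<lambda>(x, v). g x v) (\<lambda>(x, v). x \<in> D \<and> v \<in> V) (x, v))"
proof -
  obtain w where w: "\<And>x. w x \<in> V" "\<And>x v. v \<in> V \<Longrightarrow> g x (w x) \<le> g x v"
    using att unfolding attains_min_iff by metis
  have h_eq: "h x = g x (w x)" for x
    unfolding h using w by (intro INF_eq_minimum)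
  show ?thesis
  proof
    assume x: "is_arg_min h (\<lambda>x. x \<in> D) x"
    have "is_arg_min (\<lambda>(x, v). g x v) (\<lambda>(x, v). x \<in> D \<and> v \<in> V) (x, w x)"
      using x w unfolding is_arg_min_linorder h_eq by (auto intro: order.trans)
    then show "\<exists>v. is_arg_min (\<lambda>(x, v). g x v) (\<lambda>(x, v). x \<in> D \<and> v \<in> V) (x, v)" ..
  next
    assume "\<exists>v. is_arg_min (\<lambda>(x, v). g x v) (\<lambda>(x, v). x \<in> D \<and> v \<in> V) (x, v)"
    then obtain v where v: "x \<in> D" "v \<in> V"
        "\<And>y u. y \<in> D \<Longrightarrow> u \<in> V \<Longrightarrow> g x v \<le> g y u"
      unfolding is_arg_min_linorder by auto
    then show "is_arg_min h (\<lambda>x. x \<in> D) x"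
      unfolding is_arg_min_linorder h_eq using w by (meson order.trans)
  qed
qed

subsection \<open>Expectations under a discrete distribution\<close>

text \<open>The atoms carry total mass 1, so almost everywhere the integrand equals a finite
  combination of their indicators. This also settles integrability.\<close>

lemma (in prob_space) expectation_discrete:
  fixes s :: "'j::finite \<Rightarrow> 'b" and g :: "'b \<Rightarrow> real"
  assumes "inj s"
    and sets: "\<And>j. {\<omega> \<in> space M. T \<omega> = s j} \<in> events"
    and total: "(\<Sum>j\<in>UNIV. prob {\<omega> \<in> space M. T \<omega> = s j}) = 1"
    and meas: "(\<lambda>\<omega>. g (T \<omega>)) \<in> borel_measurable M"
  shows "expectation (\<lambda>\<omega>. g (T \<omega>)) = (\<Sum>j\<in>UNIV. prob {\<omega> \<in> space M. T \<omega> = s j} * g (s j))"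
proof -
  let ?A = "\<lambda>j. {\<omega> \<in> space M. T \<omega> = s j}"
  have disj: "disjoint_family ?A"
    using \<open>inj s\<close> by (auto simp: disjoint_family_on_def inj_eq)
  have "prob (\<Union>j. ?A j) = 1"
    using finite_measure_finite_Union[of UNIV ?A] sets disj total by auto
  then have "AE \<omega> in M. \<omega> \<in> (\<Union>j. ?A j)"
    using sets by (intro AE_prob_1) auto
  then have "AE \<omega> in M. g (T \<omega>) = (\<Sum>j\<in>UNIV. indicator (?A j) \<omega> * g (s j))"
  proof (rule AE_mp, intro AE_I2 impI)
    fix \<omega> assume "\<omega> \<in> (\<Union>j. ?A j)"
    then obtain j where j: "\<omega> \<in> space M" "T \<omega> = s j" by auto
    \<comment> \<open>By injectivity of \<open>s\<close>, exactly one of the indicators is nonzero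
      at \<open>\<omega>\<close>.\<close>
    have "(\<Sum>j\<in>UNIV. indicator (?A j) \<omega> * g (s j)) = (\<Sum>j'\<in>UNIV. if j' = j then g (s j) else 0)"
      using j \<open>inj s\<close> by (intro sum.cong) (auto simp: indicator_def inj_eq)
    then show "g (T \<omega>) = (\<Sum>j\<in>UNIV. indicator (?A j) \<omega> * g (s j))"
      using j by simp
  qed
  then have "expectation (\<lambda>\<omega>. g (T \<omega>)) = expectation (\<lambda>\<omega>. \<Sum>j\<in>UNIV. indicator (?A j) \<omega> * g (s j))"
    by (intro integral_cong_AE borel_measurable_sum borel_measurable_times
        borel_measurable_indicator borel_measurable_const meas sets)
  also have "\<dots> = (\<Sum>j\<in>UNIV. expectation (\<lambda>\<omega>. indicator (?A j) \<omega> * g (s j)))"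
    using sets by (intro Bochner_Integration.integral_sum integrable_mult_left integrable_real_indicator)
      (auto simp: emeasure_eq_measure)
  also have "\<dots> = (\<Sum>j\<in>UNIV. prob (?A j) * g (s j))"
    using sets by (intro sum.cong) auto
  finally show ?thesis .
qed

section \<open>Hinge functions and their weighted means\<close>

text \<open>With \<open>a = 1 / \<alpha>\<close> this is the Rockafellar-Uryasev integrand of the
  conditional value at risk for a single outcome \<open>c\<close>.\<close>

definition hinge :: "real \<Rightarrow> real \<Rightarrow> real \<Rightarrow> real" where
  "hinge a c v = a * max (v - c) 0 - v"

text \<open>The slope in \<open>v\<close> is \<open>-1\<close> below the kink \<open>c\<close> and
  \<open>a - 1\<close>, which is nonnegative, above it. Moving \<open>v\<close> to the nearest point
  of an interval containing \<open>c\<close> therefore cannot increase the value.\<close>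

lemma hinge_clamp_le:
  assumes a: "1 \<le> a" and c: "\<bar>c\<bar> \<le> B"
  shows "hinge a c (max (-B) (min B v)) \<le> hinge a c v"
proof -
  consider "v < -B" | "-B \<le> v" "v \<le> B" | "B < v" by linarith
  then show ?thesis
  proof cases
    case 1
    then have "max (-B) (min B v) = -B" "max (-B - c) 0 = 0" "max (v - c) 0 = 0"
      using c by auto
    then show ?thesis using 1 by (simp add: hinge_def)
  next
    case 2
    then show ?thesis by (simp add: max_def min_def)
  next
    case 3
    have "0 \<le> (a - 1) * (v - B)"
      using 3 a by simp
    moreover have "max (-B) (min B v) = B" "max (B - c) 0 = B - c" "max (v - c) 0 = v - c"
      using 3 c by auto
    ultimately show ?thesis
      by (simp add: hinge_def algebra_simps)
  qed
qed

text \<open>Convexity is joint in \<open>c\<close> and \<open>v\<close>, since the positive part is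
  convex and is applied to the linear expression \<open>v - c\<close>.\<close>

lemma hinge_convex_comb:
  assumes a: "0 \<le> a" and t: "0 \<le> t" "t \<le> 1"
  shows "hinge a ((1 - t) * c + t * d) ((1 - t) * v + t * w) \<le> (1 - t) * hinge a c v + t * hinge a d w"
proof -
  have "max ((1 - t) * (v - c) + t * (w - d)) 0 \<le> (1 - t) * max (v - c) 0 + t * max (w - d) 0"
    using t by (intro max.boundedI add_mono mult_left_mono add_nonneg_nonneg mult_nonneg_nonneg) auto
  then have "a * max ((1 - t) * (v - c) + t * (w - d)) 0 \<le> a * ((1 - t) * max (v - c) 0 + t * max (w - d) 0)"
    using a by (rule mult_left_mono)
  moreover have "(1 - t) * v + t * w - ((1 - t) * c + t * d) = (1 - t) * (v - c) + t * (w - d)"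
    by (simp add: algebra_simps)
  ultimately show ?thesis
    unfolding hinge_def by (simp add: algebra_simps)
qed

text \<open>The term \<open>- v\<close> sits inside the weighted sum, which makes the whole
  expression linear in the weight vector \<open>p\<close>; it matches \<open>Psi\<close> once the
  weights sum to 1.\<close>

definition hinge_mean ::
    "(real ^ 'm) \<Rightarrow> ('m::finite \<Rightarrow> (real ^ 'k) \<times> real) \<Rightarrow> real \<Rightarrow> real \<Rightarrow> real ^ 'k \<Rightarrow> real \<Rightarrow> real" where
  "hinge_mean p s a b x v = (\<Sum>j\<in>UNIV. p $ j * hinge a (x \<bullet> fst (s j) - b * snd (s j)) v)"

lemma hinge_mean_clamp_le:
  assumes "0 \<le> p" "1 \<le> a" and "\<And>j. \<bar>x \<bullet> fst (s j) - b * snd (s j)\<bar> \<le> B"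
  shows "hinge_mean p s a b x (max (-B) (min B v)) \<le> hinge_mean p s a b x v"
  unfolding hinge_mean_def using assms
  by (intro sum_mono mult_left_mono hinge_clamp_le) (auto simp: less_eq_vec_def)

lemma convex_on_hinge_mean:
  assumes p: "0 \<le> p" and a: "0 \<le> a"
  shows "convex_on UNIV (\<lambda>(x, v). hinge_mean p s a b x v)"
proof (rule convex_onI)
  fix t :: real and y z :: "(real ^ 'b) \<times> real"
  assume t: "0 < t" "t < 1"
  obtain x v x' v' where yz: "y = (x, v)" "z = (x', v')" by fastforce
  let ?c = "\<lambda>x j. x \<bullet> fst (s j) - b * snd (s j)"
  have "hinge_mean p s a b ((1 - t) *\<^sub>R x + t *\<^sub>R x') ((1 - t) * v + t * v') \<le>
      (\<Sum>j\<in>UNIV. p $ j * ((1 - t) * hinge a (?c x j) v + t * hinge a (?c x' j) v'))"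
    unfolding hinge_mean_def
  proof (intro sum_mono mult_left_mono)
    fix j
    have "?c ((1 - t) *\<^sub>R x + t *\<^sub>R x') j = (1 - t) * ?c x j + t * ?c x' j"
      by (simp add: algebra_simps inner_add_left)
    then show "hinge a (?c ((1 - t) *\<^sub>R x + t *\<^sub>R x') j) ((1 - t) * v + t * v') \<le>
        (1 - t) * hinge a (?c x j) v + t * hinge a (?c x' j) v'"
      using hinge_convex_comb[OF a, of t] t by simp
    show "0 \<le> p $ j" using p by (simp add: less_eq_vec_def)
  qed
  also have "\<dots> = (1 - t) * hinge_mean p s a b x v + t * hinge_mean p s a b x' v'"
    unfolding hinge_mean_def sum_distrib_left sum.distrib[symmetric]
    by (intro sum.cong) (simp_all add: algebra_simps)
  finally show "(case (1 - t) *\<^sub>R y + t *\<^sub>R z of (x, v) \<Rightarrow> hinge_mean p s a b x v) \<le>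
      (1 - t) * (case y of (x, v) \<Rightarrow> hinge_mean p s a b x v) +
      t * (case z of (x, v) \<Rightarrow> hinge_mean p s a b x v)"
    by (simp add: yz)
qed simp

lemma convex_on_Pair_slice:
  assumes "convex_on UNIV (\<lambda>(x, v). f x v)"
  shows "convex_on UNIV (f x)"
proof (rule convex_onI)
  fix t :: real and v w assume t: "0 < t" "t < 1"
  show "f x ((1 - t) *\<^sub>R v + t *\<^sub>R w) \<le> (1 - t) * f x v + t * f x w"
    using convex_onD[OF assms, of t "(x, v)" "(x, w)"] t
    by (simp add: scaleR_left.add[symmetric])
qed simp

lemma continuous_on_hinge_mean:
  "continuous_on S (\<lambda>(e, v). hinge_mean (p + e) s a b x v)"
  unfolding hinge_mean_def hinge_def case_prod_unfold vector_add_component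
  by (intro continuous_intros)

lemma sum_eq_inner_1:
  fixes x :: "real ^ 'm"
  shows "(\<Sum>j\<in>UNIV. x $ j) = 1 \<bullet> x"
  by (simp add: inner_vec_def)

lemma hinge_mean_eq_inner:
  "hinge_mean p s a b x v = (\<chi> j. hinge a (x \<bullet> fst (s j) - b * snd (s j)) v) \<bullet> p"
  by (simp add: hinge_mean_def inner_vec_def mult.commute)

text \<open>By linearity in the weights, the condition on \<open>e\<close> cuts a half-space out of
  \<open>E\<close>.\<close>

lemma convex_superlevel_hinge_mean:
  assumes "convex E"
  shows "convex {e \<in> E. c \<le> hinge_mean (p + e) s a b x v}"
proof -
  let ?h = "\<chi> j. hinge a (x \<bullet> fst (s j) - b * snd (s j)) v"
  have "{e \<in> E. c \<le> hinge_mean (p + e) s a b x v} = E \<inter> {e. c - ?h \<bullet> p \<le> ?h \<bullet> e}"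
    by (auto simp: hinge_mean_eq_inner inner_add_right)
  then show ?thesis
    using assms by (simp add: convex_Int convex_halfspace_ge)
qed

section \<open>Compactness of the perturbation set and of the constraint set\<close>

lemma perturbations_eq: "perturbations lo hi = cbox lo hi \<inter> {e. 1 \<bullet> e = 0}"
  by (auto simp: perturbations_def sum_eq_inner_1 mem_box_cart less_eq_vec_def)

lemma compact_perturbations: "compact (perturbations lo hi)"
  unfolding perturbations_eq by (intro compact_Int_closed compact_cbox closed_hyperplane)

lemma convex_perturbations: "convex (perturbations lo hi)"
  unfolding perturbations_eq by (intro convex_Int convex_box convex_hyperplane)

lemma compact_prob_simplex: "compact (prob_simplex :: (real ^ 'k) set)"
proof -
  have "x $ k \<le> 1" if "x \<in> prob_simplex" for x :: "real ^ 'k" and k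
    using that member_le_sum[of k UNIV "($) x"] by (simp add: prob_simplex_def)
  then have eq: "prob_simplex = cbox 0 1 \<inter> {x :: real ^ 'k. 1 \<bullet> x = 1}"
    by (auto simp: prob_simplex_def sum_eq_inner_1[symmetric] mem_box_cart)
  show ?thesis
    unfolding eq by (intro compact_Int_closed compact_cbox closed_hyperplane)
qed

text \<open>As the infimum is attained, it is a genuine lower bound, and the constraint becomes an
  intersection of closed half-spaces, one for each perturbation.\<close>

lemma compact_simplex_box:
  assumes "E \<noteq> {}" and att: "\<And>x. attains_min (expected_return Q R x) E"
  shows "compact (simplex_box E Q R \<mu>)"
proof -
  have "\<mu> \<le> (INF e\<in>E. expected_return Q R x e) \<longleftrightarrow> (\<forall>e\<in>E. \<mu> \<le> expected_return Q R x e)" for x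
    using attains_minD[OF att] \<open>E \<noteq> {}\<close> by (meson cINF_greatest order.trans)
  then have "simplex_box E Q R \<mu> =
      prob_simplex \<inter> (\<Inter>e\<in>E. {x. \<mu> \<le> (\<chi> k. \<integral>\<omega>. R k \<omega> \<partial>Q e) \<bullet> x})"
    by (auto simp: simplex_box_def expected_return_def inner_vec_def mult.commute)
  then show ?thesis
    by (simp add: compact_Int_closed compact_prob_simplex closed_INT closed_halfspace_ge)
qed

section \<open>From expectations to finite sums\<close>

lemma sets_return_vector_eq:
  assumes [measurable]: "\<And>k. R k \<in> borel_measurable M" "Z \<in> borel_measurable M"
  shows "{\<omega> \<in> space M. return_vector R Z \<omega> = c} \<in> sets M"
proof -
  have "{\<omega> \<in> space M. return_vector R Z \<omega> = c} =
      {\<omega> \<in> space M. (\<forall>k\<in>UNIV. R k \<omega> = fst c $ k) \<and> Z \<omega> = snd c}"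
    by (auto simp: return_vector_def vec_eq_iff prod_eq_iff)
  also have "\<dots> \<in> sets M"
    by measurable
  finally show ?thesis .
qed

lemma (in prob_space) sum_prob_return_vector:
  assumes meas: "\<And>k. R k \<in> borel_measurable M" "Z \<in> borel_measurable M" and "inj s"
    and "AE \<omega> in M. return_vector R Z \<omega> \<in> range s"
  shows "(\<Sum>j\<in>UNIV. prob {\<omega> \<in> space M. return_vector R Z \<omega> = (s :: 'm::finite \<Rightarrow> _) j}) = 1"
proof -
  let ?A = "\<lambda>j. {\<omega> \<in> space M. return_vector R Z \<omega> = s j}"
  have sets: "?A j \<in> events" for j
    by (rule sets_return_vector_eq[OF meas])
  have "AE \<omega> in M. \<omega> \<in> (\<Union>j. ?A j)"
    using assms(4) AE_space by eventually_elim auto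
  then have "prob (\<Union>j. ?A j) = 1"
    using sets by (subst prob_eq_1) auto
  moreover have "disjoint_family ?A"
    using \<open>inj s\<close> by (auto simp: disjoint_family_on_def inj_eq)
  ultimately show ?thesis
    using finite_measure_finite_Union[of UNIV ?A] sets by auto
qed

lemma Psi_eq_hinge_mean:
  fixes s :: "'m::finite \<Rightarrow> (real ^ 'k) \<times> real"
  assumes "prob_space (Q e)"
    and meas[measurable]: "\<And>k. R k \<in> borel_measurable (Q e)" "Z \<in> borel_measurable (Q e)"
    and "inj s"
    and p: "\<And>j. measure (Q e) {\<omega> \<in> space (Q e). return_vector R Z \<omega> = s j} = p $ j"
    and p1: "(\<Sum>j\<in>UNIV. p $ j) = 1"
  shows "Psi Q R Z \<alpha> r e i x v = hinge_mean p s (1 / \<alpha> i) (r i) x v"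
proof -
  interpret prob_space "Q e" by fact
  let ?g = "\<lambda>c. max (v - x \<bullet> fst c + r i * snd c) 0"
  have g: "max (v - (\<Sum>k\<in>UNIV. x $ k * R k \<omega>) + r i * Z \<omega>) 0 = ?g (return_vector R Z \<omega>)" for \<omega>
    by (simp add: return_vector_def inner_vec_def)
  have "(\<lambda>\<omega>. ?g (return_vector R Z \<omega>)) \<in> borel_measurable (Q e)"
    unfolding g[symmetric] by measurable
  then have "expectation (\<lambda>\<omega>. ?g (return_vector R Z \<omega>)) = (\<Sum>j\<in>UNIV. p $ j * ?g (s j))"
    using expectation_discrete[OF \<open>inj s\<close> sets_return_vector_eq[where R = R, OF meas], where g = ?g] p p1
    by simp
  \<comment> \<open>The subtracted \<open>v\<close> is multiplied by the total weight 1 so that it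
    can be distributed over the outcomes.\<close>
  then have "Psi Q R Z \<alpha> r e i x v = 1 / \<alpha> i * (\<Sum>j\<in>UNIV. p $ j * ?g (s j)) - (\<Sum>j\<in>UNIV. p $ j) * v"
    unfolding Psi_def g p1 by simp
  also have "\<dots> = (\<Sum>j\<in>UNIV. 1 / \<alpha> i * (p $ j * ?g (s j)) - p $ j * v)"
    by (simp only: sum_distrib_left sum_distrib_right sum_subtractf)
  also have "\<dots> = hinge_mean p s (1 / \<alpha> i) (r i) x v"
    unfolding hinge_mean_def hinge_def by (intro sum.cong) (simp_all add: algebra_simps)
  finally show ?thesis .
qed

lemma expected_return_eq_sum:
  fixes s :: "'m::finite \<Rightarrow> (real ^ 'k) \<times> real"
  assumes "prob_space (Q e)"
    and meas: "\<And>k. R k \<in> borel_measurable (Q e)" "Z \<in> borel_measurable (Q e)"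
    and "inj s"
    and p: "\<And>j. measure (Q e) {\<omega> \<in> space (Q e). return_vector R Z \<omega> = s j} = p $ j"
    and p1: "(\<Sum>j\<in>UNIV. p $ j) = 1"
  shows "expected_return Q R x e = (\<Sum>k\<in>UNIV. x $ k * (\<Sum>j\<in>UNIV. p $ j * fst (s j) $ k))"
proof -
  interpret prob_space "Q e" by fact
  have "expectation (R k) = (\<Sum>j\<in>UNIV. p $ j * fst (s j) $ k)" for k
    using expectation_discrete[OF \<open>inj s\<close> sets_return_vector_eq[where R = R, OF meas],
        where g = "\<lambda>c. fst c $ k"] meas p p1
    by (simp add: return_vector_def)
  then show ?thesis
    by (simp add: expected_return_def)
qed

subsection \<open>The minimax equality\<close>

theorem theorem3:
  fixes P :: "'a measure"
    and R :: "'k::finite \<Rightarrow> 'a \<Rightarrow> real"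
    and Z :: "'a \<Rightarrow> real"
    and s :: "'m::finite \<Rightarrow> (real ^ 'k) \<times> real"
    and lo hi :: "real ^ 'm"
    and Q :: "real ^ 'm \<Rightarrow> 'a measure"
    and n :: nat
    and \<alpha> r :: "nat \<Rightarrow> real"
  defines "\<pi> \<equiv> (\<chi> j. measure P {\<omega> \<in> space P. return_vector R Z \<omega> = s j})"
    and "E \<equiv> perturbations lo hi"
    and "I \<equiv> {1..n + 1}"
    and "V \<equiv> {1..n + 1} \<rightarrow>\<^sub>E (UNIV :: real set)"
    and "\<Psi> \<equiv> Psi Q R Z \<alpha> r"
  defines "\<Delta> \<equiv> simplex_box E Q R"
  assumes "prob_space P"
    and "\<And>k. R k \<in> borel_measurable P"
    and "Z \<in> borel_measurable P"
    and "inj s"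
    and "AE \<omega> in P. return_vector R Z \<omega> \<in> range s"
    and "lo \<le> hi"
    and "0 \<le> \<pi> + lo"
    and "E \<noteq> {}"
    and "\<And>\<epsilon>. \<epsilon> \<in> E \<Longrightarrow> prob_space (Q \<epsilon>)"
    and "\<And>\<epsilon>. \<epsilon> \<in> E \<Longrightarrow> sets (Q \<epsilon>) = sets P"
    and "\<And>\<epsilon> j. \<epsilon> \<in> E \<Longrightarrow>
           measure (Q \<epsilon>) {\<omega> \<in> space (Q \<epsilon>). return_vector R Z \<omega> = s j} = \<pi> $ j + \<epsilon> $ j"
    and "0 < \<alpha> 1" and "strict_mono_on I \<alpha>" and "\<alpha> (n + 1) \<le> 1"
    and "0 < r 1" and "strict_mono_on I r" and "r (n + 1) = 1"
  shows "(\<forall>x :: real ^ 'k.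
            attains_min (expected_return Q R x) E \<and>
            (\<forall>\<epsilon>\<in>E. \<forall>i\<in>I. attains_min (\<lambda>v. \<Psi> \<epsilon> i x v) UNIV) \<and>
            attains_max (\<lambda>\<epsilon>. MAX i\<in>I. INF v. \<Psi> \<epsilon> i x v) E \<and>
            (\<forall>v\<in>V. attains_max (\<lambda>\<epsilon>. MAX i\<in>I. \<Psi> \<epsilon> i x (v i)) E) \<and>
            attains_min (\<lambda>v. SUP \<epsilon>\<in>E. MAX i\<in>I. \<Psi> \<epsilon> i x (v i)) V \<and>
            (SUP \<epsilon>\<in>E. MAX i\<in>I. INF v. \<Psi> \<epsilon> i x v) =
            (INF v\<in>V. SUP \<epsilon>\<in>E. MAX i\<in>I. \<Psi> \<epsilon> i x (v i))) \<and>
         (\<forall>\<mu>.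
            (\<Delta> \<mu> \<noteq> {} \<longrightarrow>
               attains_min (\<lambda>x. SUP \<epsilon>\<in>E. MAX i\<in>I. INF v. \<Psi> \<epsilon> i x v) (\<Delta> \<mu>) \<and>
               attains_min (\<lambda>x. INF v\<in>V. SUP \<epsilon>\<in>E. MAX i\<in>I. \<Psi> \<epsilon> i x (v i)) (\<Delta> \<mu>) \<and>
               (INF x\<in>\<Delta> \<mu>. SUP \<epsilon>\<in>E. MAX i\<in>I. INF v. \<Psi> \<epsilon> i x v) =
               (INF x\<in>\<Delta> \<mu>. INF v\<in>V. SUP \<epsilon>\<in>E. MAX i\<in>I. \<Psi> \<epsilon> i x (v i))) \<and>
            (\<forall>x.
               is_arg_min (\<lambda>x. SUP \<epsilon>\<in>E. MAX i\<in>I. INF v. \<Psi> \<epsilon> i x v) (\<lambda>x. x \<in> \<Delta> \<mu>) x \<longleftrightarrow>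
               (\<exists>v. is_arg_min (\<lambda>(x, v). SUP \<epsilon>\<in>E. MAX i\<in>I. \<Psi> \<epsilon> i x (v i))
                      (\<lambda>(x, v). x \<in> \<Delta> \<mu> \<and> v \<in> V) (x, v))))"
proof -
  \<comment> \<open>Stated for any \<open>M\<close> with the sigma-algebra of \<open>P\<close>, so
    that it transfers to every \<open>Q \<epsilon>\<close>.\<close>
  have meas: "\<And>k. R k \<in> borel_measurable M" "Z \<in> borel_measurable M" if "sets M = sets P" for M
    using assms(8,9) measurable_cong_sets[OF that refl] by auto
  have compE: "compact E" and convE: "convex E"
    unfolding E_def by (rule compact_perturbations convex_perturbations)+
  have I: "finite I" "I \<noteq> {}"
    by (simp_all add: I_def)
  have prob: "prob_space (Q \<epsilon>)" and
      Qmeas: "\<And>k. R k \<in> borel_measurable (Q \<epsilon>)" "Z \<in> borel_measurable (Q \<epsilon>)" and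
      p: "\<And>j. measure (Q \<epsilon>) {\<omega> \<in> space (Q \<epsilon>). return_vector R Z \<omega> = s j} = (\<pi> + \<epsilon>) $ j"
      if "\<epsilon> \<in> E" for \<epsilon>
    using assms(15,17) meas[OF assms(16)] that by auto
  have "(\<Sum>j\<in>UNIV. \<pi> $ j) = 1"
    using prob_space.sum_prob_return_vector[OF assms(7-11)] by (simp add: \<pi>_def)
  then have p1: "(\<Sum>j\<in>UNIV. (\<pi> + \<epsilon>) $ j) = 1" if "\<epsilon> \<in> E" for \<epsilon>
    using that by (simp add: sum.distrib E_def perturbations_def)
  \<comment> \<open>The components are probabilities under \<open>Q \<epsilon>\<close>.\<close>
  have p0: "0 \<le> \<pi> + \<epsilon>" if "\<epsilon> \<in> E" for \<epsilon>
    unfolding less_eq_vec_def p[OF that, symmetric] by simp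
  have \<alpha>: "0 < \<alpha> i" "1 \<le> 1 / \<alpha> i" if i: "i \<in> I" for i
  proof -
    have "\<alpha> 1 \<le> \<alpha> i" "\<alpha> i \<le> \<alpha> (n + 1)"
      using strict_mono_on_leD[OF assms(19)] i by (auto simp: I_def)
    then show "0 < \<alpha> i" "1 \<le> 1 / \<alpha> i"
      using assms(18,20) by auto
  qed
  have \<Psi>: "\<Psi> \<epsilon> i x v = hinge_mean (\<pi> + \<epsilon>) s (1 / \<alpha> i) (r i) x v" if "\<epsilon> \<in> E" for \<epsilon> i x v
    unfolding \<Psi>_def
    by (rule Psi_eq_hinge_mean[where Q = Q and R = R,
        OF prob[OF that] Qmeas[OF that] assms(10) p[OF that] p1[OF that]])

  have att_ER: "attains_min (expected_return Q R x) E" for x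
  proof (rule compact_attains_min[OF compE assms(14)])
    have "continuous_on E (\<lambda>\<epsilon>. \<Sum>k\<in>UNIV. x $ k * (\<Sum>j\<in>UNIV. (\<pi> + \<epsilon>) $ j * fst (s j) $ k))"
      unfolding vector_add_component by (intro continuous_intros)
    then show "continuous_on E (expected_return Q R x)"
    proof (rule continuous_on_eq)
      fix \<epsilon> assume \<epsilon>: "\<epsilon> \<in> E"
      show "(\<Sum>k\<in>UNIV. x $ k * (\<Sum>j\<in>UNIV. (\<pi> + \<epsilon>) $ j * fst (s j) $ k)) = expected_return Q R x \<epsilon>"
        by (rule expected_return_eq_sum[where Q = Q and R = R, symmetric,
            OF prob[OF \<epsilon>] Qmeas[OF \<epsilon>] assms(10) p[OF \<epsilon>] p1[OF \<epsilon>]])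
    qed
  qed

  \<comment> \<open>The sum of the absolute values dominates every kink of the hinge mean. It
    depends on \<open>i\<close> and \<open>x\<close> but not on \<open>\<epsilon>\<close>, so the
    clamping is uniform over \<open>E\<close>.\<close>
  define B where "B i x = (\<Sum>j\<in>UNIV. \<bar>x \<bullet> fst (s j) - r i * snd (s j)\<bar>)" for i and x :: "real ^ 'k"
  have B0: "0 \<le> B i x" for i x
    by (simp add: B_def sum_nonneg)
  have clamp: "\<Psi> \<epsilon> i x (max (- B i x) (min (B i x) v)) \<le> \<Psi> \<epsilon> i x v"
    if "\<epsilon> \<in> E" "i \<in> I" for \<epsilon> i x v
    unfolding \<Psi>[OF that(1)] B_def
    using p0[OF that(1)] \<alpha>(2)[OF that(2)]
    by (intro hinge_mean_clamp_le member_le_sum) auto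
  have cont: "continuous_on (E \<times> UNIV) (\<lambda>(\<epsilon>, v). \<Psi> \<epsilon> i x v)" for i x
    using continuous_on_hinge_mean[of "E \<times> UNIV" \<pi> s "1 / \<alpha> i" "r i" x]
    by (rule continuous_on_eq) (auto simp: \<Psi>)
  have conv: "convex_on UNIV (\<lambda>(x, v). \<Psi> \<epsilon> i x v)" if "\<epsilon> \<in> E" "i \<in> I" for \<epsilon> i
    unfolding \<Psi>[OF that(1)]
    using p0[OF that(1)] \<alpha>(1)[OF that(2)] by (intro convex_on_hinge_mean) auto
  have quasi: "convex {\<epsilon> \<in> E. c \<le> \<Psi> \<epsilon> i x v}" for c i x v
    \<comment> \<open>The formula for \<open>\<Psi>\<close> holds only on \<open>E\<close>;
      \<open>conj_cong\<close> makes the membership available when rewriting the second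
      conjunct.\<close>
    using convex_superlevel_hinge_mean[OF convE, of c \<pi> s "1 / \<alpha> i" "r i" x v]
    by (simp add: \<Psi> cong: conj_cong)

  have att_v: "attains_min (\<lambda>v. \<Psi> \<epsilon> i x v) UNIV" if "\<epsilon> \<in> E" "i \<in> I" for \<epsilon> i x
  proof -
    have "continuous_on UNIV (\<Psi> \<epsilon> i x)"
      using convex_on_Pair_slice[OF conv[OF that]] by (intro convex_on_continuous) auto
    then have "attains_min (\<Psi> \<epsilon> i x) {- B i x..B i x}"
      using B0[of i x] by (intro compact_attains_min) (auto intro: continuous_on_subset)
    then obtain w where w: "\<And>v. v \<in> {- B i x..B i x} \<Longrightarrow> \<Psi> \<epsilon> i x w \<le> \<Psi> \<epsilon> i x v"
      unfolding attains_min_iff by blast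
    have "\<Psi> \<epsilon> i x w \<le> \<Psi> \<epsilon> i x v" for v
      using w[of "max (- B i x) (min (B i x) v)"] clamp[OF that, of x v] B0[of i x] by simp
    then show ?thesis
      unfolding attains_min_iff by blast
  qed
  have att_e: "attains_max (\<lambda>\<epsilon>. \<Psi> \<epsilon> i x v) E" for i x v
    by (rule compact_attains_max[OF compE assms(14) continuous_on_slice[OF cont]])

  have "\<exists>e w. e \<in> E \<and> (\<forall>e'\<in>E. \<Psi> e' i x w \<le> \<Psi> e i x w) \<and> (\<forall>v. \<Psi> e i x w \<le> \<Psi> e i x v)"
    if i: "i \<in> I" for i x
    using saddle_point_exists[OF compE assms(14) cont quasi convex_on_Pair_slice[OF conv[OF _ i]]
        clamp[OF _ i] B0] by metis
  \<comment> \<open>In this object-level form the choice principles produce saddle points as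
    functions of \<open>x\<close> and \<open>i\<close> simultaneously.\<close>
  then have "\<forall>x. \<forall>i\<in>I. \<exists>e w. e \<in> E \<and> (\<forall>e'\<in>E. \<Psi> e' i x w \<le> \<Psi> e i x w) \<and> (\<forall>v. \<Psi> e i x w \<le> \<Psi> e i x v)"
    by blast
  then obtain e w where saddle: "\<forall>x. \<forall>i\<in>I. e x i \<in> E \<and>
      (\<forall>e'\<in>E. \<Psi> e' i x (w x i) \<le> \<Psi> (e x i) i x (w x i)) \<and> (\<forall>v. \<Psi> (e x i) i x (w x i) \<le> \<Psi> (e x i) i x v)"
    unfolding bchoice_iff choice_iff by blast
  then have e: "\<And>i x. i \<in> I \<Longrightarrow> e x i \<in> E"
    and saddle_max: "\<And>i e' x. i \<in> I \<Longrightarrow> e' \<in> E \<Longrightarrow> \<Psi> e' i x (w x i) \<le> \<Psi> (e x i) i x (w x i)"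
    and saddle_min: "\<And>i v x. i \<in> I \<Longrightarrow> \<Psi> (e x i) i x (w x i) \<le> \<Psi> (e x i) i x v"
    by blast+
  define val where "val x = (MAX i\<in>I. \<Psi> (e x i) i x (w x i))" for x
  have V: "V = I \<rightarrow>\<^sub>E UNIV"
    by (simp add: V_def I_def)
  have minimax:
    "attains_max (\<lambda>\<epsilon>. MAX i\<in>I. INF v. \<Psi> \<epsilon> i x v) E"
    "(SUP \<epsilon>\<in>E. MAX i\<in>I. INF v. \<Psi> \<epsilon> i x v) = val x"
    "attains_min (\<lambda>v. SUP \<epsilon>\<in>E. MAX i\<in>I. \<Psi> \<epsilon> i x (v i)) V"
    "(INF v\<in>V. SUP \<epsilon>\<in>E. MAX i\<in>I. \<Psi> \<epsilon> i x (v i)) = val x" for x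
    unfolding V val_def
    by - (rule minimax_of_saddle_points[where f = "\<lambda>\<epsilon> i. \<Psi> \<epsilon> i x" and e = "e x" and w = "w x", OF I];
        blast intro: e saddle_max saddle_min att_v att_e)+
  have att_Max: "attains_max (\<lambda>\<epsilon>. MAX i\<in>I. \<Psi> \<epsilon> i x (v i)) E" for x v
    by (rule attains_max_Max[OF I att_e])

  \<comment> \<open>A real-valued convex function on the whole finite-dimensional space is
    continuous, so \<open>val\<close> attains its minimum on the compact set
    \<open>\<Delta> \<mu>\<close> whenever that set is nonempty.\<close>
  have "convex_on UNIV val"
    unfolding val_def by (rule convex_on_max_of_saddle_points[OF I e saddle_max saddle_min conv])
  then have "continuous_on UNIV val"
    by (intro convex_on_continuous) auto
  then have att_val: "attains_min val (\<Delta> \<mu>)" if "\<Delta> \<mu> \<noteq> {}" for \<mu>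
    using that compact_simplex_box[OF assms(14) att_ER]
    by (intro compact_attains_min) (auto simp: \<Delta>_def intro: continuous_on_subset)
  have argmin: "is_arg_min val (\<lambda>x. x \<in> \<Delta> \<mu>) x \<longleftrightarrow>
      (\<exists>v. is_arg_min (\<lambda>(x, v). SUP \<epsilon>\<in>E. MAX i\<in>I. \<Psi> \<epsilon> i x (v i))
        (\<lambda>(x, v). x \<in> \<Delta> \<mu> \<and> v \<in> V) (x, v))" for \<mu> x
    by (rule is_arg_min_iterated[OF minimax(3) minimax(4)[symmetric]])

  \<comment> \<open>Both sides of the minimax equality rewrite to \<open>val x\<close>, so the
    equalities become reflexive and the attainment claims for \<open>x\<close> become
    \<open>att_val\<close>.\<close>
  show ?thesis
    unfolding minimax(2) minimax(4)
    by (intro conjI allI impI ballI att_ER att_v minimax(1) att_Max minimax(3) att_val refl argmin)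
qed

end
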